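(* Let $\mathcal{R}_1=\{W_w,V_{w,v},\Lambda_w,\alpha_{w,v}\}_{w\in\Omega,v\in\Omega_w}$ be a continuous relay fusion frame for $H$ with bounds $A$ and $B$. Suppose that $\{Z_{w,v}\}_{v\in\Omega_w}$ is a family of closed subspaces of $K_w$ for each $w\in\Omega$ and that there exists a constant $0<C<A$ such that $$\int_\Omega\int_{\Omega_w}\alpha_{w,v}^2\|P_{V_{w,v}}\Lambda_w\pi_{W_w}f-P_{Z_{w,v}}\Lambda_w\pi_{W_w}f\|^2\,d\mu(v)\,d\mu(w)\le C\|f\|^2\quad\forall f\in H.$$ Then $\mathcal{R}_2=\{W_w,Z_{w,v},\Lambda_w,\alpha_{w,v}\}_{w\in\Omega,v\in\Omega_w}$ is a continuous relay fusion frame for $H$ with bounds $$(\sqrt C-\sqrt A)^2,\qquad(\sqrt C+\sqrt B)^2.$$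
   Context: Setting. $H$ is a separable Hilbert space and $(\Omega,\mu)$ is a positive measure space; for each $w\in\Omega$, $\Omega_w$ is a positive measure space whose measure is also denoted $\mu$. For each $w\in\Omega$, $K_w$ is a separable Hilbert space, $W_w\subseteq H$ is a closed subspace, $\Lambda_w\in B(H,K_w)$, and $\{V_{w,v}\}_{v\in\Omega_w}$ is a family of closed subspaces of $K_w$; $\alpha_{w,v}>0$ are weights. $\pi_W$ and $P_V$ denote orthogonal projections onto closed subspaces $W$ of $H$ and $V$ of $K_w$. Families of subspaces, operators and weights are understood to be measurable (in the sense of (1)–(3) below) so that the integrals written make sense. Definition. $\mathcal{R}=\{W_w,V_{w,v},\Lambda_w,\alpha_{w,v}\}_{w\in\Omega,v\in\Omega_w}$ is a continuous relay fusion frame for $H$ with (lower and upper) bounds $A,B$ if: (1) for each $f\in H$, $\{\Lambda_wf\}_{w\in\Omega}$ is strongly measurable; (2) for each $f\in H$, $\{\pi_{W_w}f\}_{w\in\Omega}$ is strongly measurable; (3) for each $f\in K_w$, $\{P_{V_{w,v}}f\}_{w\in\Omega,v\in\Omega_w}$ is strongly measurable; (4) the constants $0<A\le B<\infty$ satisfy $$A\|f\|^2\le\int_\Omega\int_{\Omega_w}\alpha_{w,v}^2\|P_{V_{w,v}}\Lambda_w\pi_{W_w}f\|^2\,d\mu(v)\,d\mu(w)\le B\|f\|^2\quad\forall f\in H.$$ *)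

theory Defs
  imports "HOL-Analysis.Analysis"
begin

definition closed_subspace :: "'a::real_normed_vector set \<Rightarrow> bool" where
  "closed_subspace S \<longleftrightarrow> subspace S \<and> closed S"

(* The orthogonal projection onto S. The described point exists and is unique when S is a closed
   subspace of a Hilbert space, the only case in which it is used. For S contained in a closed
   subspace K, its restriction to K is the orthogonal projection of the Hilbert space K onto S. *)
definition orth_proj :: "'a::real_inner set \<Rightarrow> 'a \<Rightarrow> 'a" where
  "orth_proj S x = (THE y. y \<in> S \<and> (\<forall>z\<in>S. orthogonal (x - y) z))"

(* Bochner's notion: almost everywhere the limit of a sequence of simple functions. For values in
   real or ennreal this says that f agrees almost everywhere with a Borel measurable function. *)
definition strongly_measurable :: "'a measure \<Rightarrow> ('a \<Rightarrow> 'b::topological_space) \<Rightarrow> bool" where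
  "strongly_measurable M f \<longleftrightarrow>
     (\<exists>s. (\<forall>i. simple_function M (s i)) \<and> (AE x in M. (\<lambda>i::nat. s i x) \<longlonglongrightarrow> f x))"

(* M is the measure space Omega and N w is the measure space Omega_w. *)
definition fibre_integral ::
  "('w \<Rightarrow> 'v measure) \<Rightarrow> ('w \<Rightarrow> 'v \<Rightarrow> real) \<Rightarrow> ('w \<Rightarrow> 'v \<Rightarrow> 'k::real_normed_vector) \<Rightarrow> 'w \<Rightarrow> ennreal"
where
  "fibre_integral N \<alpha> g w = (\<integral>\<^sup>+ v. ennreal ((\<alpha> w v)\<^sup>2 * (norm (g w v))\<^sup>2) \<partial>N w)"

definition relay_integral ::
  "'w measure \<Rightarrow> ('w \<Rightarrow> 'v measure) \<Rightarrow> ('w \<Rightarrow> 'v \<Rightarrow> real) \<Rightarrow>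
     ('w \<Rightarrow> 'v \<Rightarrow> 'k::real_normed_vector) \<Rightarrow> ennreal"
where
  "relay_integral M N \<alpha> g = (\<integral>\<^sup>+ w. fibre_integral N \<alpha> g w \<partial>M)"

(* The Hilbert spaces K w are closed separable subspaces of one ambient Hilbert space 'k. This is
   no restriction (take the Hilbert direct sum of the K w) and gives w |-> Lambda_w f a codomain.
   Complex Hilbert spaces are covered through the real inner product Re <x, y>, for which norms and
   projections onto closed complex subspaces are unchanged. *)
definition relay_family ::
  "'w measure \<Rightarrow> ('w \<Rightarrow> 'v measure) \<Rightarrow> ('w \<Rightarrow> 'k::{real_inner, complete_space} set) \<Rightarrow>
     ('w \<Rightarrow> 'h::{real_inner, polish_space} set) \<Rightarrow> ('w \<Rightarrow> 'v \<Rightarrow> 'k set) \<Rightarrow>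
     ('w \<Rightarrow> 'h \<Rightarrow> 'k) \<Rightarrow> ('w \<Rightarrow> 'v \<Rightarrow> real) \<Rightarrow> bool"
where
  "relay_family M N K W V \<Lambda> \<alpha> \<longleftrightarrow>
     (\<forall>w\<in>space M.
        closed_subspace (K w) \<and> separable_space (top_of_set (K w)) \<and>
        closed_subspace (W w) \<and>
        bounded_linear (\<Lambda> w) \<and> range (\<Lambda> w) \<subseteq> K w \<and>
        strongly_measurable (N w) (\<alpha> w) \<and>
        (\<forall>v\<in>space (N w). closed_subspace (V w v) \<and> V w v \<subseteq> K w \<and> \<alpha> w v > 0))"

(* The clause on fibre_integral is the requirement that the outer integral in the frame
   inequality makes sense; the inner one does so by the measurability of the weights and of the
   projections P_{V w v}. *)
definition continuous_relay_fusion_frame ::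
  "'w measure \<Rightarrow> ('w \<Rightarrow> 'v measure) \<Rightarrow> ('w \<Rightarrow> 'k::{real_inner, complete_space} set) \<Rightarrow>
     ('w \<Rightarrow> 'h::{real_inner, polish_space} set) \<Rightarrow> ('w \<Rightarrow> 'v \<Rightarrow> 'k set) \<Rightarrow>
     ('w \<Rightarrow> 'h \<Rightarrow> 'k) \<Rightarrow> ('w \<Rightarrow> 'v \<Rightarrow> real) \<Rightarrow> real \<Rightarrow> real \<Rightarrow> bool"
where
  "continuous_relay_fusion_frame M N K W V \<Lambda> \<alpha> A B \<longleftrightarrow>
     relay_family M N K W V \<Lambda> \<alpha> \<and>
     (\<forall>f. strongly_measurable M (\<lambda>w. \<Lambda> w f)) \<and>
     (\<forall>f. strongly_measurable M (\<lambda>w. orth_proj (W w) f)) \<and>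
     (\<forall>w\<in>space M. \<forall>f\<in>K w. strongly_measurable (N w) (\<lambda>v. orth_proj (V w v) f)) \<and>
     (\<forall>f. strongly_measurable M
            (fibre_integral N \<alpha> (\<lambda>w v. orth_proj (V w v) (\<Lambda> w (orth_proj (W w) f))))) \<and>
     0 < A \<and> A \<le> B \<and>
     (\<forall>f. ennreal (A * (norm f)\<^sup>2)
            \<le> relay_integral M N \<alpha> (\<lambda>w v. orth_proj (V w v) (\<Lambda> w (orth_proj (W w) f))) \<and>
          relay_integral M N \<alpha> (\<lambda>w v. orth_proj (V w v) (\<Lambda> w (orth_proj (W w) f)))
            \<le> ennreal (B * (norm f)\<^sup>2))"

end

theory Submission
  imports Defs
begin

text \<open>The weighted form \<open>(a + b)\<^sup>2 \<le> (1 + t) a\<^sup>2 + (1 + 1/t) b\<^sup>2\<close> of the triangle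
  inequality can be integrated term by term, so Minkowski's inequality for the iterated integral
  follows by choosing the best \<open>t\<close>, and no \<open>L\<^sup>2\<close> space of the direct integral is needed. With
  \<open>t = sqrt (C / B)\<close> it gives the upper bound, and with \<open>t = sqrt C / (sqrt A - sqrt C)\<close> the
  lower one.\<close>

lemma square_le_weighted_sum_squares:
  fixes a b c t :: real
  assumes "0 \<le> c" "c \<le> a + b" "0 < t"
  shows "c\<^sup>2 \<le> (1 + t) * a\<^sup>2 + (1 + 1 / t) * b\<^sup>2"
proof -
  have "c\<^sup>2 \<le> (a + b)\<^sup>2"
    using assms by (intro power_mono) auto
  \<comment> \<open>The defect is a square over \<open>t\<close>, so equality holds when
    \<open>t * a = b\<close>; this equality case dictates the values of \<open>t\<close> chosen
    later.\<close>
  moreover have "(1 + t) * a\<^sup>2 + (1 + 1 / t) * b\<^sup>2 - (a + b)\<^sup>2 = (t * a - b)\<^sup>2 / t"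
    using assms by (simp add: field_simps power2_eq_square)
  moreover have "(t * a - b)\<^sup>2 / t \<ge> 0"
    using assms by simp
  ultimately show ?thesis by linarith
qed

text \<open>Combining simple approximants of \<open>f\<close> and \<open>g\<close> pointwise by
  \<open>h\<close> gives simple functions again, and \<open>cont\<close>, joint sequential
  continuity of \<open>h\<close>, carries the two a.e. limits over. It serves for differences of
  vector fields and for weighted squared norms.\<close>

lemma strongly_measurable_compose2:
  assumes f: "strongly_measurable M f" and g: "strongly_measurable M g"
    and cont: "\<And>s t x y. s \<longlonglongrightarrow> x \<Longrightarrow> t \<longlonglongrightarrow> y \<Longrightarrow> (\<lambda>i. h (s i) (t i)) \<longlonglongrightarrow> h x y"
  shows "strongly_measurable M (\<lambda>x. h (f x) (g x))"
proof -
  obtain s where s: "\<And>i. simple_function M (s i)" "AE x in M. (\<lambda>i. s i x) \<longlonglongrightarrow> f x"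
    using f by (auto simp: strongly_measurable_def)
  obtain t where t: "\<And>i. simple_function M (t i)" "AE x in M. (\<lambda>i. t i x) \<longlonglongrightarrow> g x"
    using g by (auto simp: strongly_measurable_def)
  have "AE x in M. (\<lambda>i. h (s i x) (t i x)) \<longlonglongrightarrow> h (f x) (g x)"
    using s(2) t(2) by eventually_elim (rule cont)
  then show ?thesis
    unfolding strongly_measurable_def
    using s(1) t(1) by (intro exI[of _ "\<lambda>i x. h (s i x) (t i x)"]) (auto intro: simple_function_compose2)
qed

text \<open>The limsup of the simple approximants exists at every point, also where they diverge,
  and is Borel; it equals the limit wherever they converge.\<close>

lemma strongly_measurable_AE_borel:
  fixes f :: "'a \<Rightarrow> ennreal"
  assumes "strongly_measurable M f"
  obtains g where "g \<in> borel_measurable M" "AE x in M. f x = g x"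
proof -
  obtain s where s: "\<And>i. simple_function M (s i)" "AE x in M. (\<lambda>i. s i x) \<longlonglongrightarrow> f x"
    using assms by (auto simp: strongly_measurable_def)
  have [measurable]: "s i \<in> borel_measurable M" for i
    by (rule borel_measurable_simple_function[OF s(1)])
  have "(\<lambda>x. limsup (\<lambda>i. s i x)) \<in> borel_measurable M"
    by measurable
  moreover have "AE x in M. f x = limsup (\<lambda>i. s i x)"
    using s(2) by eventually_elim (auto dest: lim_imp_Limsup[rotated])
  ultimately show thesis by (rule that)
qed

text \<open>Additivity of the integral is used for Borel functions only, so \<open>f\<close> and
  \<open>g\<close> are exchanged for a.e. equal Borel representatives and exchanged back afterwards.
  For \<open>h\<close> monotonicity suffices.\<close>

lemma nn_integral_le_weighted_sum:
  fixes f g h :: "'a \<Rightarrow> ennreal"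
  assumes f: "strongly_measurable M f" and g: "strongly_measurable M g"
    and le: "\<And>x. x \<in> space M \<Longrightarrow> h x \<le> a * f x + b * g x"
  shows "(\<integral>\<^sup>+x. h x \<partial>M) \<le> a * (\<integral>\<^sup>+x. f x \<partial>M) + b * (\<integral>\<^sup>+x. g x \<partial>M)"
proof -
  obtain f' where [measurable]: "f' \<in> borel_measurable M" and f': "AE x in M. f x = f' x"
    by (rule strongly_measurable_AE_borel[OF f])
  obtain g' where [measurable]: "g' \<in> borel_measurable M" and g': "AE x in M. g x = g' x"
    by (rule strongly_measurable_AE_borel[OF g])
  have "(\<integral>\<^sup>+x. h x \<partial>M) \<le> (\<integral>\<^sup>+x. a * f' x + b * g' x \<partial>M)"
  proof (rule nn_integral_mono_AE)
    show "AE x in M. h x \<le> a * f' x + b * g' x"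
      using f' g' AE_space by eventually_elim (metis le)
  qed
  also have "\<dots> = a * (\<integral>\<^sup>+x. f' x \<partial>M) + b * (\<integral>\<^sup>+x. g' x \<partial>M)"
    by (simp add: nn_integral_add nn_integral_cmult)
  also have "\<dots> = a * (\<integral>\<^sup>+x. f x \<partial>M) + b * (\<integral>\<^sup>+x. g x \<partial>M)"
    using nn_integral_cong_AE[OF f'] nn_integral_cong_AE[OF g'] by simp
  finally show ?thesis .
qed

lemma strongly_measurable_weighted_square:
  fixes g :: "'v \<Rightarrow> 'k::real_normed_vector"
  assumes "strongly_measurable M a" "strongly_measurable M g"
  shows "strongly_measurable M (\<lambda>v. ennreal ((a v)\<^sup>2 * (norm (g v))\<^sup>2))"
  by (rule strongly_measurable_compose2[OF assms])
     (intro tendsto_ennrealI tendsto_intros)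

text \<open>The factors \<open>1 + t\<close> and \<open>1 + 1 / t\<close> do not depend on
  \<open>v\<close>, so the weighted triangle inequality, multiplied by the squared weight,
  integrates over the fibre.\<close>

lemma fibre_integral_le_weighted_sum:
  fixes f g h :: "'w \<Rightarrow> 'v \<Rightarrow> 'k::real_normed_vector"
  assumes "strongly_measurable (N w) (\<alpha> w)"
    and "strongly_measurable (N w) (f w)" "strongly_measurable (N w) (g w)"
    and tri: "\<And>v. v \<in> space (N w) \<Longrightarrow> norm (h w v) \<le> norm (f w v) + norm (g w v)"
    and t: "0 < t"
  shows "fibre_integral N \<alpha> h w
    \<le> ennreal (1 + t) * fibre_integral N \<alpha> f w + ennreal (1 + 1 / t) * fibre_integral N \<alpha> g w"
  unfolding fibre_integral_def
proof (rule nn_integral_le_weighted_sum)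
  fix v assume v: "v \<in> space (N w)"
  have "(\<alpha> w v)\<^sup>2 * (norm (h w v))\<^sup>2
      \<le> (\<alpha> w v)\<^sup>2 * ((1 + t) * (norm (f w v))\<^sup>2 + (1 + 1 / t) * (norm (g w v))\<^sup>2)"
    by (intro mult_left_mono square_le_weighted_sum_squares tri v t) auto
  also have "\<dots> = (1 + t) * ((\<alpha> w v)\<^sup>2 * (norm (f w v))\<^sup>2)
      + (1 + 1 / t) * ((\<alpha> w v)\<^sup>2 * (norm (g w v))\<^sup>2)"
    by (simp add: algebra_simps)
  finally show "ennreal ((\<alpha> w v)\<^sup>2 * (norm (h w v))\<^sup>2)
      \<le> ennreal (1 + t) * ennreal ((\<alpha> w v)\<^sup>2 * (norm (f w v))\<^sup>2)
        + ennreal (1 + 1 / t) * ennreal ((\<alpha> w v)\<^sup>2 * (norm (g w v))\<^sup>2)"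
    using t by (simp flip: ennreal_mult ennreal_plus add: ennreal_leI)
qed (intro strongly_measurable_weighted_square assms)+

text \<open>The same \<open>t\<close> serves every fibre, so the fibre estimate can be integrated
  once more over \<open>M\<close>; \<open>t\<close> is optimised only after both
  integrations.\<close>

lemma relay_integral_le_weighted_sum:
  fixes f g h :: "'w \<Rightarrow> 'v \<Rightarrow> 'k::real_normed_vector"
  assumes "\<And>w. w \<in> space M \<Longrightarrow> strongly_measurable (N w) (\<alpha> w)"
    and "\<And>w. w \<in> space M \<Longrightarrow> strongly_measurable (N w) (f w)"
    and "\<And>w. w \<in> space M \<Longrightarrow> strongly_measurable (N w) (g w)"
    and "strongly_measurable M (fibre_integral N \<alpha> f)"
    and "strongly_measurable M (fibre_integral N \<alpha> g)"
    and "\<And>w v. w \<in> space M \<Longrightarrow> v \<in> space (N w) \<Longrightarrow> norm (h w v) \<le> norm (f w v) + norm (g w v)"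
    and "0 < t"
  shows "relay_integral M N \<alpha> h
    \<le> ennreal (1 + t) * relay_integral M N \<alpha> f + ennreal (1 + 1 / t) * relay_integral M N \<alpha> g"
  unfolding relay_integral_def
  by (intro nn_integral_le_weighted_sum fibre_integral_le_weighted_sum assms)

text \<open>Here \<open>I\<close>, \<open>J\<close> and \<open>X\<close> stand for the relay
  integrals of the old field, the difference and the new field, and \<open>n\<close> for the squared
  norm of the vector.\<close>

lemma minkowski_upper_bound:
  fixes I J X :: ennreal
  assumes "0 < B" "0 < C" "0 \<le> n"
    and I: "I \<le> ennreal (B * n)" and J: "J \<le> ennreal (C * n)"
    and X: "\<And>t. 0 < t \<Longrightarrow> X \<le> ennreal (1 + t) * I + ennreal (1 + 1 / t) * J"
  shows "X \<le> ennreal ((sqrt C + sqrt B)\<^sup>2 * n)"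
proof -
  \<comment> \<open>In the extremal case the two fields have norms proportional to \<open>b\<close>
    and \<open>c\<close>, and equality in the weighted inequality asks for
    \<open>t * b = c\<close>.\<close>
  define b c t where "b = sqrt B" and "c = sqrt C" and "t = c / b"
  have pos: "0 < b" "0 < c" "0 < t" and BC: "B = b\<^sup>2" "C = c\<^sup>2"
    using assms by (auto simp: b_def c_def t_def)
  have "X \<le> ennreal (1 + t) * ennreal (B * n) + ennreal (1 + 1 / t) * ennreal (C * n)"
    by (rule order_trans[OF X[OF pos(3)]]) (intro add_mono mult_left_mono I J zero_le)
  also have "\<dots> = ennreal ((1 + t) * (B * n) + (1 + 1 / t) * (C * n))"
    using assms pos by (simp flip: ennreal_mult ennreal_plus)
  \<comment> \<open>Since \<open>1 + t = (b + c) / b\<close> and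
    \<open>1 + 1 / t = (b + c) / c\<close>, the coefficient of \<open>n\<close> is
    \<open>b * (b + c) + c * (b + c)\<close>.\<close>
  also have "(1 + t) * (B * n) + (1 + 1 / t) * (C * n) = (c + b)\<^sup>2 * n"
    using pos unfolding BC t_def by (simp add: field_simps power2_eq_square)
  finally show ?thesis by (simp add: b_def c_def)
qed

text \<open>The weighted inequality is now used with the old field on the left and solved for the
  integral \<open>X\<close> of the new one.\<close>

lemma minkowski_lower_bound:
  fixes I J X :: ennreal
  assumes "0 < C" "C < A" "0 \<le> n"
    and I: "ennreal (A * n) \<le> I" and J: "J \<le> ennreal (C * n)"
    and X: "\<And>t. 0 < t \<Longrightarrow> I \<le> ennreal (1 + t) * X + ennreal (1 + 1 / t) * J"
  shows "ennreal ((sqrt C - sqrt A)\<^sup>2 * n) \<le> X"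
proof (cases X)
  \<comment> \<open>An infinite \<open>X\<close> satisfies the bound trivially; a finite one allows
    subtraction in the reals.\<close>
  case (real x)
  \<comment> \<open>In the extremal case the new field has norm proportional to \<open>a - c\<close>
    and the difference to \<open>c\<close>, so equality asks for
    \<open>t * (a - c) = c\<close>.\<close>
  define a c t where "a = sqrt A" and "c = sqrt C" and "t = c / (a - c)"
  have pos: "0 < c" "c < a" "0 < t" and AC: "A = a\<^sup>2" "C = c\<^sup>2"
    using assms by (auto simp: a_def c_def t_def)
  have t: "1 + t = a / (a - c)" "1 + 1 / t = a / c"
    using pos by (auto simp: t_def field_simps)
  have "ennreal (A * n) \<le> ennreal (1 + t) * ennreal x + ennreal (1 + 1 / t) * ennreal (C * n)"
    by (rule order_trans[OF I], rule order_trans[OF X[OF pos(3)]])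
       (intro add_mono mult_left_mono J zero_le, simp add: real)
  also have "\<dots> = ennreal ((1 + t) * x + (1 + 1 / t) * (C * n))"
    using assms pos real by (simp flip: ennreal_mult ennreal_plus)
  finally have "A * n \<le> (1 + t) * x + (1 + 1 / t) * (C * n)"
    using assms pos real by (subst (asm) ennreal_le_iff) auto
  \<comment> \<open>With this \<open>t\<close> both coefficients on the right contain the factor
    \<open>a\<close>, as does \<open>A = a * a\<close>, so it cancels.\<close>
  then have "a * (a * n) \<le> a * (x / (a - c) + c * n)"
    using pos unfolding t AC by (simp add: field_simps power2_eq_square)
  then have "a * n \<le> x / (a - c) + c * n"
    using pos by (simp add: mult_le_cancel_left)
  then have "(a - c) * n \<le> x / (a - c)"
    by (simp add: left_diff_distrib)
  then have "(a - c) * n * (a - c) \<le> x"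
    using pos by (subst (asm) pos_le_divide_eq) auto
  then have "(c - a)\<^sup>2 * n \<le> x"
    by (simp add: power2_eq_square algebra_simps)
  then show ?thesis
    by (simp add: real a_def c_def ennreal_leI)
qed simp

theorem theorem4p2:
  fixes M :: "'w measure"
    and N :: "'w \<Rightarrow> 'v measure"
    and K :: "'w \<Rightarrow> 'k::{real_inner, complete_space} set"
    and W :: "'w \<Rightarrow> 'h::{real_inner, polish_space} set"
    and V Z :: "'w \<Rightarrow> 'v \<Rightarrow> 'k set"
    and \<Lambda> :: "'w \<Rightarrow> 'h \<Rightarrow> 'k"
    and \<alpha> :: "'w \<Rightarrow> 'v \<Rightarrow> real"
    and A B C :: real
  assumes frame: "continuous_relay_fusion_frame M N K W V \<Lambda> \<alpha> A B"
    and Z_subspace: "\<And>w v. w \<in> space M \<Longrightarrow> v \<in> space (N w) \<Longrightarrow> closed_subspace (Z w v) \<and> Z w v \<subseteq> K w"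
    and Z_measurable: "\<And>w f. w \<in> space M \<Longrightarrow> f \<in> K w \<Longrightarrow>
          strongly_measurable (N w) (\<lambda>v. orth_proj (Z w v) f)"
    and Z_integral_defined: "\<And>f. strongly_measurable M
          (fibre_integral N \<alpha> (\<lambda>w v. orth_proj (Z w v) (\<Lambda> w (orth_proj (W w) f))))"
    and diff_integral_defined: "\<And>f. strongly_measurable M
          (fibre_integral N \<alpha> (\<lambda>w v. orth_proj (V w v) (\<Lambda> w (orth_proj (W w) f))
                                  - orth_proj (Z w v) (\<Lambda> w (orth_proj (W w) f))))"
    and C: "0 < C" "C < A"
    and close: "\<And>f. relay_integral M N \<alpha>
          (\<lambda>w v. orth_proj (V w v) (\<Lambda> w (orth_proj (W w) f))
                - orth_proj (Z w v) (\<Lambda> w (orth_proj (W w) f)))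
          \<le> ennreal (C * (norm f)\<^sup>2)"
  shows "continuous_relay_fusion_frame M N K W Z \<Lambda> \<alpha>
           ((sqrt C - sqrt A)\<^sup>2) ((sqrt C + sqrt B)\<^sup>2)"
proof -
  define gV where "gV f = (\<lambda>w v. orth_proj (V w v) (\<Lambda> w (orth_proj (W w) f)))" for f
  define gZ where "gZ f = (\<lambda>w v. orth_proj (Z w v) (\<Lambda> w (orth_proj (W w) f)))" for f
  define gD where "gD f = (\<lambda>w v. gV f w v - gZ f w v)" for f
  have family: "relay_family M N K W V \<Lambda> \<alpha>" and AB: "0 < A" "A \<le> B"
    and V_meas: "\<And>w f. w \<in> space M \<Longrightarrow> f \<in> K w \<Longrightarrow>
      strongly_measurable (N w) (\<lambda>v. orth_proj (V w v) f)"
    and V_int: "\<And>f. strongly_measurable M (fibre_integral N \<alpha> (gV f))"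
    and V_lower: "\<And>f. ennreal (A * (norm f)\<^sup>2) \<le> relay_integral M N \<alpha> (gV f)"
    and V_upper: "\<And>f. relay_integral M N \<alpha> (gV f) \<le> ennreal (B * (norm f)\<^sup>2)"
    using frame unfolding continuous_relay_fusion_frame_def gV_def by auto
  have \<alpha>_meas: "strongly_measurable (N w) (\<alpha> w)" and in_K: "\<Lambda> w x \<in> K w"
    if "w \<in> space M" for w x
    using family that unfolding relay_family_def by blast+
  \<comment> \<open>For fixed \<open>w\<close> the projected vector is constant in \<open>v\<close>
    and lies in \<open>K w\<close>, the only vectors for which measurability of the projections is
    given.\<close>
  have gV_meas: "strongly_measurable (N w) (gV f w)" and gZ_meas: "strongly_measurable (N w) (gZ f w)"
    if "w \<in> space M" for w f
    using V_meas Z_measurable in_K that by (auto simp: gV_def gZ_def)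
  have gD_meas: "strongly_measurable (N w) (gD f w)" if "w \<in> space M" for w f
    unfolding gD_def
    by (rule strongly_measurable_compose2[OF gV_meas gZ_meas]) (auto intro: that tendsto_diff)
  \<comment> \<open>Measurability in \<open>v\<close> on each fibre does not control how the fibre
    integrals vary with \<open>w\<close>; that comes from the hypotheses.\<close>
  have D_int: "strongly_measurable M (fibre_integral N \<alpha> (gD f))" for f
    using diff_integral_defined unfolding gD_def gV_def gZ_def .
  have Z_int: "strongly_measurable M (fibre_integral N \<alpha> (gZ f))" for f
    using Z_integral_defined unfolding gZ_def .
  have D_upper: "relay_integral M N \<alpha> (gD f) \<le> ennreal (C * (norm f)\<^sup>2)" for f
    using close unfolding gD_def gV_def gZ_def .
  \<comment> \<open>The identities \<open>gZ = gV - gD\<close> and \<open>gV = gZ + gD\<close> give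
    one inequality for each frame bound.\<close>
  have tri: "norm (gZ f w v) \<le> norm (gV f w v) + norm (gD f w v)"
    "norm (gV f w v) \<le> norm (gZ f w v) + norm (gD f w v)" for f w v
    unfolding gD_def by norm+
  have "relay_integral M N \<alpha> (gZ f) \<le> ennreal (1 + t) * relay_integral M N \<alpha> (gV f)
      + ennreal (1 + 1 / t) * relay_integral M N \<alpha> (gD f)" if "0 < t" for f t
    by (rule relay_integral_le_weighted_sum)
       (auto intro: \<alpha>_meas gV_meas gD_meas V_int D_int that tri)
  then have upper: "relay_integral M N \<alpha> (gZ f) \<le> ennreal ((sqrt C + sqrt B)\<^sup>2 * (norm f)\<^sup>2)" for f
    by (intro minkowski_upper_bound[OF _ _ _ V_upper D_upper]) (use AB C in auto)
  have "relay_integral M N \<alpha> (gV f) \<le> ennreal (1 + t) * relay_integral M N \<alpha> (gZ f)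
      + ennreal (1 + 1 / t) * relay_integral M N \<alpha> (gD f)" if "0 < t" for f t
    by (rule relay_integral_le_weighted_sum)
       (auto intro: \<alpha>_meas gZ_meas gD_meas Z_int D_int that tri)
  then have lower: "ennreal ((sqrt C - sqrt A)\<^sup>2 * (norm f)\<^sup>2) \<le> relay_integral M N \<alpha> (gZ f)" for f
    by (intro minkowski_lower_bound[OF _ _ _ V_lower D_upper]) (use C in auto)
  \<comment> \<open>The frame definition also demands that the bounds be ordered: the left root has
    absolute value \<open>sqrt A - sqrt C\<close>, which is below \<open>sqrt B\<close>.\<close>
  have "(sqrt C - sqrt A)\<^sup>2 \<le> (sqrt C + sqrt B)\<^sup>2"
  proof (rule abs_le_square_iff[THEN iffD1])
    have "sqrt A \<le> sqrt B" "0 < sqrt C" "sqrt C < sqrt A"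
      using AB C by auto
    then show "\<bar>sqrt C - sqrt A\<bar> \<le> \<bar>sqrt C + sqrt B\<bar>"
      by linarith
  qed
  \<comment> \<open>Strictness of \<open>C < A\<close> keeps the new lower bound positive.\<close>
  moreover have "0 < (sqrt C - sqrt A)\<^sup>2"
    using C by simp
  moreover have "relay_family M N K W Z \<Lambda> \<alpha>"
    using family Z_subspace unfolding relay_family_def by auto
  ultimately show ?thesis
    using frame Z_measurable Z_integral_defined lower upper
    unfolding continuous_relay_fusion_frame_def gZ_def by auto
qed

end
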